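(* Let $n\ge 1$, consider the integer lattice graph $\mathbb{Z}^n$, and let $f:\mathbb{Z}^n\to\mathbb{R}$. Assume that $V:\mathbb{Z}^n\to\mathbb{R}$ satisfies, for some $\alpha\in[0,2]$ and $c_0>0$, $$V(x)\ge c_0\,(1+|x|)^{-\alpha}\quad\text{for all }x\in\mathbb{Z}^n .$$ Then there exists at most one solution $u:\mathbb{Z}^n\to\mathbb{R}$ of $\Delta u-Vu=f$ in $\mathbb{Z}^n$ such that $$\lim_{|x|\to+\infty}\frac{u(x)}{Z(x)}=0,$$ where, whenever $|x|>2$, $Z(x):=-|x|^{2-\alpha}$ if $\alpha\in[0,2)$ and $Z(x):=-\log|x|$ if $\alpha=2$.
   Context: Integer lattice graph: the vertex set is $\mathbb{Z}^n$; $x\sim y$ if and only if there is $k\in\{1,\dots,n\}$ with $x_k=y_k\pm1$ and $x_i=y_i$ for $i\ne k$; the edge weight is $\omega(x,y)=1$ if $x\sim y$ and $0$ otherwise; the node measure is $\mu(x)=2n$. Here $|x|=\big(\sum_{k=1}^n|x_k|^2\big)^{1/2}$ is the Euclidean norm. The Laplace operator is $\Delta f(x)=\frac1{2n}\sum_{y\sim x}[f(y)-f(x)]$ for $f:\mathbb{Z}^n\to\mathbb{R}$. A function $u:\mathbb{Z}^n\to\mathbb{R}$ is a solution of $\Delta u-Vu=f$ in $\mathbb{Z}^n$ if $\Delta u(x)-V(x)u(x)=f(x)$ for every $x\in\mathbb{Z}^n$. *)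

theory Defs
  imports "HOL-Analysis.Analysis"
begin

text \<open>The vertex set of the integer lattice graph of dimension n = CARD('n) is the type
  \<open>int ^ 'n\<close>; index types are nonempty, so n \<open>\<ge>\<close> 1.\<close>

definition lattice_norm :: "int ^ 'n \<Rightarrow> real" where
  "lattice_norm x = sqrt (\<Sum>k\<in>UNIV. \<bar>real_of_int (x $ k)\<bar>\<^sup>2)"

definition adjacent :: "int ^ 'n \<Rightarrow> int ^ 'n \<Rightarrow> bool" where
  "adjacent x y \<longleftrightarrow>
     (\<exists>k. (x $ k = y $ k + 1 \<or> x $ k = y $ k - 1) \<and> (\<forall>i. i \<noteq> k \<longrightarrow> x $ i = y $ i))"

text \<open>The sum in the Laplacian ranges over a genuinely finite set.\<close>

lemma finite_adjacent: "finite {y :: int ^ 'n. adjacent x y}"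
proof (rule finite_subset)
  show "{y. adjacent x y} \<subseteq>
      (\<lambda>(k, d). \<chi> i. if i = k then x $ i + d else x $ i) ` (UNIV \<times> {-1, 1})"
  proof
    fix y assume "y \<in> {y. adjacent x y}"
    then obtain k where k: "x $ k = y $ k + 1 \<or> x $ k = y $ k - 1"
      and eq: "\<And>i. i \<noteq> k \<Longrightarrow> x $ i = y $ i"
      by (auto simp: adjacent_def)
    have "y = (\<lambda>(k, d). \<chi> i. if i = k then x $ i + d else x $ i) (k, y $ k - x $ k)"
      using eq by (auto simp: vec_eq_iff)
    moreover have "(k, y $ k - x $ k) \<in> UNIV \<times> {-1, 1}"
      using k by auto
    ultimately show
      "y \<in> (\<lambda>(k, d). \<chi> i. if i = k then x $ i + d else x $ i) ` (UNIV \<times> {-1, 1})"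
      by (rule image_eqI)
  qed
qed simp

text \<open>Edge weight 1 and node measure 2n.\<close>

definition laplacian :: "(int ^ 'n \<Rightarrow> real) \<Rightarrow> int ^ 'n \<Rightarrow> real" where
  "laplacian u x = 1 / (2 * real CARD('n)) * (\<Sum>y\<in>{y. adjacent x y}. u y - u x)"

definition is_solution ::
  "(int ^ 'n \<Rightarrow> real) \<Rightarrow> (int ^ 'n \<Rightarrow> real) \<Rightarrow> (int ^ 'n \<Rightarrow> real) \<Rightarrow> bool" where
  "is_solution V f u \<longleftrightarrow> (\<forall>x. laplacian u x - V x * u x = f x)"

text \<open>Only the values with |x| > 2 are meaningful. The formula is used at every point, which does
  not affect limits as |x| tends to infinity. Intended for \<open>0 \<le> \<alpha> \<le> 2\<close>.\<close>

definition Z :: "real \<Rightarrow> int ^ 'n \<Rightarrow> real" where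
  "Z \<alpha> x = (if \<alpha> < 2 then - (lattice_norm x powr (2 - \<alpha>)) else - ln (lattice_norm x))"

definition lattice_at_infinity :: "(int ^ 'n) filter" where
  "lattice_at_infinity = filtercomap lattice_norm at_top"

end

theory Submission
  imports Defs
begin

text \<open>
  The difference \<open>w\<close> of two solutions satisfies \<open>\<Delta> w = V w\<close> and \<open>w = o(Z)\<close>. Since \<open>V > 0\<close>, the
  maximum principle bounds \<open>w\<close> by any function \<open>\<psi>\<close> with \<open>\<Delta> \<psi> \<le> V \<psi>\<close> that dominates \<open>w\<close> off a
  finite set. It therefore suffices to find a single positive supersolution \<open>\<phi>\<close> that grows at
  least like \<open>\<bar>Z\<bar>\<close>: then \<open>w \<le> \<epsilon> \<phi>\<close> for every \<open>\<epsilon> > 0\<close>, so \<open>w \<le> 0\<close>, and exchanging the two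
  solutions gives \<open>w = 0\<close>.

  The supersolution is \<open>\<phi>(x) = G(|x|\<^sup>2) + 2 / c\<^sub>0\<close>, where \<open>G\<close> is a nonnegative concave function with
  \<open>G'(s) \<le> (1 + s) powr (-\<alpha>/2)\<close>, namely a power of \<open>1 + s\<close> or, for \<open>\<alpha> = 2\<close>, its logarithm.
  Concavity gives \<open>\<Delta> \<phi>(x) \<le> G'(|x|\<^sup>2) \<Delta>|x|\<^sup>2\<close>, and \<open>\<Delta>|x|\<^sup>2 = 1\<close> exactly, so no discrete Taylor
  expansion is needed. Finally \<open>(1 + |x|)\<^sup>2 \<le> 2 (1 + |x|\<^sup>2)\<close> shows that the additive constant
  alone already makes \<open>V \<phi> \<ge> 2 (1 + |x|) powr (-\<alpha>) \<ge> (1 + |x|\<^sup>2) powr (-\<alpha>/2) \<ge> \<Delta> \<phi>\<close>, at every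
  lattice point and for every \<open>0 \<le> \<alpha> \<le> 2\<close>.
\<close>

section \<open>The Laplacian on the integer lattice\<close>

lemma lattice_norm_nonneg: "0 \<le> lattice_norm x"
  by (simp add: lattice_norm_def sum_nonneg)

lemma lattice_norm_sq: "(lattice_norm x)\<^sup>2 = (\<Sum>k\<in>UNIV. (real_of_int (x $ k))\<^sup>2)"
  by (simp add: lattice_norm_def sum_nonneg)

text \<open>Every statement at infinity on the lattice concerns all but finitely many points.\<close>

lemma finite_lattice_norm_le: "finite {x :: int ^ 'n. lattice_norm x \<le> R}"
proof -
  have "\<bar>x $ k\<bar> \<le> \<lfloor>R\<rfloor>" if "lattice_norm x \<le> R" for x :: "int ^ 'n" and k
  proof -
    have "\<bar>real_of_int (x $ k)\<bar>\<^sup>2 \<le> (\<Sum>k\<in>UNIV. \<bar>real_of_int (x $ k)\<bar>\<^sup>2)"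
      by (rule member_le_sum) auto
    hence "\<bar>real_of_int (x $ k)\<bar> \<le> lattice_norm x"
      unfolding lattice_norm_def by (rule real_le_rsqrt)
    thus ?thesis using that by (simp add: le_floor_iff)
  qed
  hence bound: "-\<lfloor>R\<rfloor> \<le> x $ k \<and> x $ k \<le> \<lfloor>R\<rfloor>" if "lattice_norm x \<le> R" for x :: "int ^ 'n" and k
    using that by (simp add: abs_le_iff minus_le_iff)
  have "{x :: int ^ 'n. lattice_norm x \<le> R} \<subseteq> vec_lambda ` (UNIV \<rightarrow>\<^sub>E {-\<lfloor>R\<rfloor>..\<lfloor>R\<rfloor>})"
  proof
    fix x :: "int ^ 'n" assume "x \<in> {x. lattice_norm x \<le> R}"
    hence "vec_nth x \<in> UNIV \<rightarrow>\<^sub>E {-\<lfloor>R\<rfloor>..\<lfloor>R\<rfloor>}" using bound by auto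
    thus "x \<in> vec_lambda ` (UNIV \<rightarrow>\<^sub>E {-\<lfloor>R\<rfloor>..\<lfloor>R\<rfloor>})"
      by (metis vec_nth_inverse image_eqI)
  qed
  moreover have "finite (vec_lambda ` ((UNIV :: 'n set) \<rightarrow>\<^sub>E {-\<lfloor>R\<rfloor>..\<lfloor>R\<rfloor>}))"
    by (intro finite_imageI finite_PiE) auto
  ultimately show ?thesis by (rule finite_subset)
qed

lemma laplacian_diff: "laplacian (\<lambda>x. u x - v x) x = laplacian u x - laplacian v x"
  unfolding laplacian_def right_diff_distrib[symmetric] sum_subtractf[symmetric]
  by (simp add: algebra_simps)

lemma laplacian_cmult: "laplacian (\<lambda>x. c * u x) x = c * laplacian u x"
proof -
  have "(\<Sum>y\<in>{y. adjacent x y}. c * u y - c * u x) = c * (\<Sum>y\<in>{y. adjacent x y}. u y - u x)"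
    by (simp add: sum_distrib_left right_diff_distrib)
  thus ?thesis by (simp add: laplacian_def)
qed

lemma laplacian_mono:
  assumes "\<And>y. adjacent x y \<Longrightarrow> u y - u x \<le> v y - v x"
  shows "laplacian u x \<le> laplacian v x"
  unfolding laplacian_def using assms by (intro mult_left_mono sum_mono) auto

text \<open>The increments \<open>\<plusminus>2 x\<^sub>k + 1\<close> in the two directions of each axis add up to \<open>2\<close>.\<close>

lemma laplacian_lattice_norm_sq: "laplacian (\<lambda>x. (lattice_norm x)\<^sup>2) (x :: int ^ 'n) = 1"
proof -
  define shift where "shift = (\<lambda>(k, d). \<chi> i. if i = k then x $ i + d else x $ i)"
  have inj: "inj_on shift (UNIV \<times> {-1, 1})"
  proof (rule inj_onI, clarify)
    fix k l :: 'n and d e :: int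
    assume d: "d \<in> {-1, 1}" and eq: "shift (k, d) = shift (l, e)"
    have "shift (k, d) $ k = shift (l, e) $ k" "shift (k, d) $ l = shift (l, e) $ l"
      using eq by simp_all
    thus "k = l \<and> d = e" using d by (auto simp: shift_def split: if_splits)
  qed
  have img: "shift ` (UNIV \<times> {-1, 1}) = {y. adjacent x y}"
  proof (intro equalityI subsetI)
    fix y assume "y \<in> {y. adjacent x y}"
    then obtain k where k: "x $ k = y $ k + 1 \<or> x $ k = y $ k - 1"
      and eq: "\<And>i. i \<noteq> k \<Longrightarrow> x $ i = y $ i"
      by (auto simp: adjacent_def)
    have "y = shift (k, y $ k - x $ k)"
      using eq by (auto simp: vec_eq_iff shift_def)
    moreover have "(k, y $ k - x $ k) \<in> UNIV \<times> {-1, 1}"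
      using k by auto
    ultimately show "y \<in> shift ` (UNIV \<times> {-1, 1})" by (rule image_eqI)
  qed (auto simp: shift_def adjacent_def)
  have incr: "(lattice_norm (shift (k, d)))\<^sup>2 - (lattice_norm x)\<^sup>2
      = 2 * real_of_int d * real_of_int (x $ k) + (real_of_int d)\<^sup>2" for k d
  proof -
    have "(lattice_norm (shift (k, d)))\<^sup>2 - (lattice_norm x)\<^sup>2
        = (\<Sum>i\<in>UNIV. if i = k
            then 2 * real_of_int d * real_of_int (x $ k) + (real_of_int d)\<^sup>2 else 0)"
      unfolding lattice_norm_sq sum_subtractf[symmetric]
      by (rule sum.cong) (auto simp: shift_def power2_eq_square algebra_simps)
    thus ?thesis by simp
  qed
  have "(\<Sum>y\<in>{y. adjacent x y}. (lattice_norm y)\<^sup>2 - (lattice_norm x)\<^sup>2)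
      = (\<Sum>p\<in>UNIV \<times> {-1, 1}. (lattice_norm (shift p))\<^sup>2 - (lattice_norm x)\<^sup>2)"
    unfolding img[symmetric] using inj by (simp add: sum.reindex)
  also have "\<dots> = (\<Sum>k\<in>UNIV. \<Sum>d\<in>{-1, 1}.
      (lattice_norm (shift (k, d)))\<^sup>2 - (lattice_norm x)\<^sup>2)"
    unfolding sum.cartesian_product by (rule sum.cong) auto
  also have "\<dots> = 2 * real CARD('n)"
    unfolding incr by simp
  finally show ?thesis by (simp add: laplacian_def)
qed

section \<open>Comparison of subsolutions and supersolutions\<close>

text \<open>The maximum principle: where \<open>w - \<psi>\<close> is maximal, \<open>\<Delta> w \<le> \<Delta> \<psi>\<close>, whereas a positive value of
  \<open>w - \<psi>\<close> there would force \<open>\<Delta> w \<ge> V w > V \<psi> \<ge> \<Delta> \<psi>\<close>. Finiteness guarantees a maximum.\<close>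

lemma comparison_principle:
  assumes V: "\<And>x. V x > 0"
    and sub: "\<And>x. V x * w x \<le> laplacian w x"
    and super: "\<And>x. laplacian \<psi> x \<le> V x * \<psi> x"
    and fin: "finite {x. w x > \<psi> x}"
  shows "w x \<le> \<psi> x"
proof (rule ccontr)
  assume "\<not> w x \<le> \<psi> x"
  hence ne: "{x. w x > \<psi> x} \<noteq> {}" by (auto simp: not_le)
  obtain z where z: "w z > \<psi> z"
    and max: "\<And>y. w y > \<psi> y \<Longrightarrow> w y - \<psi> y \<le> w z - \<psi> z"
  proof -
    have "Max ((\<lambda>x. w x - \<psi> x) ` {x. w x > \<psi> x}) \<in> (\<lambda>x. w x - \<psi> x) ` {x. w x > \<psi> x}"
      using fin ne by (intro Max_in) auto
    then obtain z where z: "w z > \<psi> z"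
      and eq: "Max ((\<lambda>x. w x - \<psi> x) ` {x. w x > \<psi> x}) = w z - \<psi> z"
      by auto
    have "w y - \<psi> y \<le> w z - \<psi> z" if "w y > \<psi> y" for y
      unfolding eq[symmetric] using fin that by (intro Max_ge) auto
    thus thesis using that z by blast
  qed
  have "w y - w z \<le> \<psi> y - \<psi> z" for y
    using max[of y] z by (cases "w y > \<psi> y") auto
  hence "laplacian w z \<le> laplacian \<psi> z" by (intro laplacian_mono)
  hence "V z * w z \<le> V z * \<psi> z" using sub[of z] super[of z] by linarith
  thus False using V[of z] z by simp
qed

text \<open>A subsolution that is negligible against a positive supersolution \<open>\<phi>\<close> is compared with
  \<open>\<epsilon> \<phi>\<close> for every \<open>\<epsilon> > 0\<close>.\<close>

lemma nonpos_if_negligible: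
  fixes w :: "int ^ 'n \<Rightarrow> real"
  assumes V: "\<And>x. V x > 0"
    and sub: "\<And>x. V x * w x \<le> laplacian w x"
    and super: "\<And>x. laplacian \<phi> x \<le> V x * \<phi> x"
    and pos: "\<And>x. \<phi> x > 0"
    and small: "\<And>\<epsilon>. \<epsilon> > 0 \<Longrightarrow> \<forall>\<^sub>F x in lattice_at_infinity. w x \<le> \<epsilon> * \<phi> x"
  shows "w x \<le> 0"
proof -
  have le: "w x \<le> \<epsilon> * \<phi> x" if \<epsilon>: "\<epsilon> > 0" for \<epsilon>
  proof (rule comparison_principle[OF V sub])
    show "laplacian (\<lambda>x. \<epsilon> * \<phi> x) y \<le> V y * (\<epsilon> * \<phi> y)" for y
      using mult_left_mono[OF super[of y], of \<epsilon>] \<epsilon>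
      by (simp add: laplacian_cmult mult.left_commute)
    obtain R where R: "\<And>y :: int ^ 'n. lattice_norm y \<ge> R \<Longrightarrow> w y \<le> \<epsilon> * \<phi> y"
      using small[OF \<epsilon>]
      unfolding lattice_at_infinity_def eventually_filtercomap eventually_at_top_linorder by blast
    have "{y. w y > \<epsilon> * \<phi> y} \<subseteq> {y. lattice_norm y \<le> R}"
      using R by (force simp: not_le[symmetric])
    thus "finite {y. w y > \<epsilon> * \<phi> y}"
      using finite_lattice_norm_le finite_subset by blast
  qed
  show ?thesis
  proof (rule ccontr)
    assume "\<not> w x \<le> 0"
    thus False using le[of "w x / (2 * \<phi> x)"] pos[of x] by (simp add: field_simps)
  qed
qed

section \<open>A radial supersolution\<close>

lemma tangent_above_if_deriv_antimono:
  fixes G g :: "real \<Rightarrow> real"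
  assumes deriv: "\<And>s. s \<ge> 0 \<Longrightarrow> (G has_real_derivative g s) (at s)"
    and anti: "\<And>s t. 0 \<le> s \<Longrightarrow> s \<le> t \<Longrightarrow> g t \<le> g s"
    and "0 \<le> s" "0 \<le> t"
  shows "G t - G s \<le> g s * (t - s)"
proof (cases s t rule: linorder_cases)
  case less
  then obtain z where z: "s < z" "z < t" "G t - G s = (t - s) * g z"
    using MVT2[of s t G g] deriv \<open>0 \<le> s\<close> by auto
  have "(t - s) * g z \<le> (t - s) * g s"
    using anti[of s z] z less \<open>0 \<le> s\<close> by (intro mult_left_mono) auto
  thus ?thesis using z by (simp add: mult.commute)
next
  case greater
  then obtain z where z: "t < z" "z < s" "G s - G t = (s - t) * g z"
    using MVT2[of t s G g] deriv \<open>0 \<le> t\<close> by auto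
  have "(s - t) * g s \<le> (s - t) * g z"
    using anti[of z s] z greater \<open>0 \<le> t\<close> by (intro mult_left_mono) auto
  thus ?thesis using z by (simp add: algebra_simps)
qed simp

text \<open>Composing \<open>|x|\<^sup>2\<close> with a concave function: the tangent inequality is summed over the
  neighbours, and \<open>\<Delta>|x|\<^sup>2 = 1\<close> leaves just the slope.\<close>

lemma laplacian_concave_radial_le:
  fixes G g :: "real \<Rightarrow> real"
  assumes "\<And>s. s \<ge> 0 \<Longrightarrow> (G has_real_derivative g s) (at s)"
    and "\<And>s t. 0 \<le> s \<Longrightarrow> s \<le> t \<Longrightarrow> g t \<le> g s"
  shows "laplacian (\<lambda>x. G ((lattice_norm x)\<^sup>2) + C) x \<le> g ((lattice_norm x)\<^sup>2)"
proof -
  let ?s = "(lattice_norm x)\<^sup>2"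
  have "laplacian (\<lambda>x. G ((lattice_norm x)\<^sup>2) + C) x
      \<le> laplacian (\<lambda>y. g ?s * (lattice_norm y)\<^sup>2) x"
  proof (rule laplacian_mono)
    fix y
    show "G ((lattice_norm y)\<^sup>2) + C - (G ?s + C) \<le> g ?s * (lattice_norm y)\<^sup>2 - g ?s * ?s"
      using tangent_above_if_deriv_antimono[of G g ?s "(lattice_norm y)\<^sup>2"] assms
      by (simp add: right_diff_distrib)
  qed
  thus ?thesis by (simp add: laplacian_cmult laplacian_lattice_norm_sq)
qed

text \<open>The profile of the supersolution: a primitive of \<open>(1 + s) powr (-\<alpha>/2)\<close>, for \<open>\<alpha> < 2\<close>
  multiplied by \<open>1 - \<alpha>/2 \<le> 1\<close> to avoid a denominator that degenerates as \<open>\<alpha>\<close> tends to \<open>2\<close>.\<close>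

lemma ex_radial_profile:
  fixes \<alpha> :: real
  assumes "0 \<le> \<alpha>" "\<alpha> \<le> 2"
  obtains G g :: "real \<Rightarrow> real"
  where "\<And>s. s \<ge> 0 \<Longrightarrow> (G has_real_derivative g s) (at s)"
    and "\<And>s t. 0 \<le> s \<Longrightarrow> s \<le> t \<Longrightarrow> g t \<le> g s"
    and "\<And>s. 0 \<le> s \<Longrightarrow> g s \<le> (1 + s) powr (- \<alpha> / 2)"
    and "\<And>s. 0 \<le> s \<Longrightarrow> 0 \<le> G s"
    and "\<And>x :: int ^ 'n. 1 \<le> lattice_norm x \<Longrightarrow> \<bar>Z \<alpha> x\<bar> \<le> G ((lattice_norm x)\<^sup>2)"
proof (cases "\<alpha> < 2")
  case True
  define \<beta> where "\<beta> = 1 - \<alpha> / 2"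
  have \<beta>: "0 < \<beta>" "\<beta> \<le> 1" using True assms by (auto simp: \<beta>_def)
  have exponent: "\<beta> - 1 = - \<alpha> / 2" by (simp add: \<beta>_def)
  show thesis
  proof (rule that[of "\<lambda>s. (1 + s) powr \<beta>" "\<lambda>s. \<beta> * (1 + s) powr (\<beta> - 1)"])
    fix s :: real assume s: "0 \<le> s"
    show "((\<lambda>s. (1 + s) powr \<beta>) has_real_derivative \<beta> * (1 + s) powr (\<beta> - 1)) (at s)"
      using s by (auto intro!: derivative_eq_intros)
    show "\<beta> * (1 + s) powr (\<beta> - 1) \<le> (1 + s) powr (- \<alpha> / 2)"
      using \<beta> by (simp add: exponent mult_left_le_one_le)
    fix t assume "s \<le> t"
    thus "\<beta> * (1 + t) powr (\<beta> - 1) \<le> \<beta> * (1 + s) powr (\<beta> - 1)"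
      using s \<beta> by (intro mult_left_mono powr_mono2') auto
  next
    fix x :: "int ^ 'n" assume x: "1 \<le> lattice_norm x"
    have "lattice_norm x powr (2 - \<alpha>) = (lattice_norm x powr 2) powr \<beta>"
      by (simp add: powr_powr \<beta>_def right_diff_distrib)
    also have "\<dots> = ((lattice_norm x)\<^sup>2) powr \<beta>"
      using x by (simp add: powr_numeral)
    also have "\<dots> \<le> (1 + (lattice_norm x)\<^sup>2) powr \<beta>"
      using \<beta> by (intro powr_mono2) auto
    finally show "\<bar>Z \<alpha> x\<bar> \<le> (1 + (lattice_norm x)\<^sup>2) powr \<beta>"
      using True by (simp add: Z_def)
  qed simp
next
  case False
  hence \<alpha>: "\<alpha> = 2" using assms by simp
  show thesis
  proof (rule that[of "\<lambda>s. ln (1 + s)" "\<lambda>s. 1 / (1 + s)"])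
    fix s :: real assume s: "0 \<le> s"
    show "((\<lambda>s. ln (1 + s)) has_real_derivative 1 / (1 + s)) (at s)"
      using s by (auto intro!: derivative_eq_intros)
    show "1 / (1 + s) \<le> (1 + s) powr (- \<alpha> / 2)"
      using s by (simp add: \<alpha> powr_minus_divide)
    show "0 \<le> ln (1 + s)" using s by simp
    fix t assume "s \<le> t"
    thus "1 / (1 + t) \<le> 1 / (1 + s)" using s by (simp add: frac_le)
  next
    fix x :: "int ^ 'n" assume x: "1 \<le> lattice_norm x"
    have "lattice_norm x \<le> (lattice_norm x)\<^sup>2"
      using x by (simp add: power2_eq_square mult_le_cancel_left1)
    hence "ln (lattice_norm x) \<le> ln (1 + (lattice_norm x)\<^sup>2)"
      using x by simp
    thus "\<bar>Z \<alpha> x\<bar> \<le> ln (1 + (lattice_norm x)\<^sup>2)"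
      using x by (simp add: Z_def \<alpha>)
  qed
qed

lemma powr_neg_half_le_twice:
  fixes r \<alpha> :: real
  assumes "0 \<le> r" "0 \<le> \<alpha>" "\<alpha> \<le> 2"
  shows "(1 + r\<^sup>2) powr (- \<alpha> / 2) \<le> 2 * (1 + r) powr (- \<alpha>)"
proof -
  have "(1 + r)\<^sup>2 \<le> 2 * (1 + r\<^sup>2)"
    using sum_squares_ge_zero[of "r - 1" 0] by (simp add: power2_eq_square algebra_simps)
  hence base: "(1 + r)\<^sup>2 / 2 \<le> 1 + r\<^sup>2" by simp
  have "(1 + r\<^sup>2) powr (- \<alpha> / 2) \<le> ((1 + r)\<^sup>2 / 2) powr (- \<alpha> / 2)"
    using base assms by (intro powr_mono2') auto
  also have "\<dots> = ((1 + r) powr 2) powr (- \<alpha> / 2) / 2 powr (- \<alpha> / 2)"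
    using assms by (simp add: powr_divide powr_numeral)
  also have "\<dots> = 2 powr (\<alpha> / 2) * (1 + r) powr (- \<alpha>)"
    by (simp add: powr_powr powr_minus divide_simps)
  also have "\<dots> \<le> 2 powr 1 * (1 + r) powr (- \<alpha>)"
    using assms by (intro mult_right_mono powr_mono) auto
  finally show ?thesis by simp
qed

text \<open>The constant \<open>2 / c\<^sub>0\<close> is chosen so that \<open>V\<close> times this constant alone absorbs \<open>\<Delta> \<phi>\<close>; the
  unbounded part of \<open>\<phi>\<close> only provides the growth.\<close>

lemma ex_supersolution:
  fixes V :: "int ^ 'n \<Rightarrow> real"
  assumes \<alpha>: "0 \<le> \<alpha>" "\<alpha> \<le> 2" and c: "c > 0"
    and V: "\<And>x. V x \<ge> c * (1 + lattice_norm x) powr (- \<alpha>)"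
  obtains \<phi> where "\<And>x. \<phi> x > 0" "\<And>x. laplacian \<phi> x \<le> V x * \<phi> x"
    and "\<And>x. 1 \<le> lattice_norm x \<Longrightarrow> \<bar>Z \<alpha> x\<bar> \<le> \<phi> x"
proof -
  obtain G g :: "real \<Rightarrow> real" where deriv: "\<And>s. s \<ge> 0 \<Longrightarrow> (G has_real_derivative g s) (at s)"
    and anti: "\<And>s t. 0 \<le> s \<Longrightarrow> s \<le> t \<Longrightarrow> g t \<le> g s"
    and g: "\<And>s. 0 \<le> s \<Longrightarrow> g s \<le> (1 + s) powr (- \<alpha> / 2)"
    and G: "\<And>s. 0 \<le> s \<Longrightarrow> 0 \<le> G s"
    and Z: "\<And>x :: int ^ 'n. 1 \<le> lattice_norm x \<Longrightarrow> \<bar>Z \<alpha> x\<bar> \<le> G ((lattice_norm x)\<^sup>2)"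
    using ex_radial_profile[OF \<alpha>] by metis
  define \<phi> :: "int ^ 'n \<Rightarrow> real" where "\<phi> = (\<lambda>x. G ((lattice_norm x)\<^sup>2) + 2 / c)"
  have lower: "2 / c \<le> \<phi> x" for x using G by (simp add: \<phi>_def)
  show thesis
  proof (rule that[of \<phi>])
    fix x :: "int ^ 'n"
    show "\<phi> x > 0" using lower[of x] c by (smt (verit) divide_pos_pos)
    have "laplacian \<phi> x \<le> g ((lattice_norm x)\<^sup>2)"
      unfolding \<phi>_def using laplacian_concave_radial_le[OF deriv anti] .
    also have "\<dots> \<le> 2 * (1 + lattice_norm x) powr (- \<alpha>)"
      using g[of "(lattice_norm x)\<^sup>2"] powr_neg_half_le_twice[OF lattice_norm_nonneg \<alpha>, of x] by simp
    also have "\<dots> = c * (1 + lattice_norm x) powr (- \<alpha>) * (2 / c)"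
      using c by simp
    also have "\<dots> \<le> V x * \<phi> x"
    proof (rule mult_mono[OF V lower])
      have "0 \<le> c * (1 + lattice_norm x) powr (- \<alpha>)" using c by simp
      thus "0 \<le> V x" using V[of x] by linarith
    qed (use c in simp)
    finally show "laplacian \<phi> x \<le> V x * \<phi> x" .
    assume "1 \<le> lattice_norm x"
    thus "\<bar>Z \<alpha> x\<bar> \<le> \<phi> x" using Z[of x] c by (simp add: \<phi>_def add_increasing2)
  qed
qed

section \<open>Uniqueness\<close>

theorem corollary3p11:
  fixes f V :: "int ^ 'n \<Rightarrow> real" and \<alpha> c\<^sub>0 :: real
  assumes "0 \<le> \<alpha>" and "\<alpha> \<le> 2" and "c\<^sub>0 > 0"
    and "\<And>x. V x \<ge> c\<^sub>0 * (1 + lattice_norm x) powr (- \<alpha>)"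
  shows "\<exists>\<^sub>\<le>\<^sub>1 u. is_solution V f u \<and> ((\<lambda>x. u x / Z \<alpha> x) \<longlongrightarrow> 0) lattice_at_infinity"
proof -
  obtain \<phi> where \<phi>: "\<And>x. \<phi> x > 0" "\<And>x. laplacian \<phi> x \<le> V x * \<phi> x"
    and Z_le: "\<And>x. 1 \<le> lattice_norm x \<Longrightarrow> \<bar>Z \<alpha> x\<bar> \<le> \<phi> x"
    using ex_supersolution[OF assms] by metis
  have V_pos: "V x > 0" for x
  proof -
    have "0 < c\<^sub>0 * (1 + lattice_norm x) powr (- \<alpha>)"
      using assms(3) lattice_norm_nonneg[of x] by simp
    thus ?thesis using assms(4)[of x] by linarith
  qed
  \<comment> \<open>For \<open>\<alpha> = 2\<close> the function \<open>Z\<close> vanishes on \<open>|x| = 1\<close>, where the quotient by \<open>Z\<close> is \<open>0\<close> by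
    convention and says nothing about the numerator.\<close>
  have far: "\<forall>\<^sub>F x :: int ^ 'n in lattice_at_infinity. 2 \<le> lattice_norm x"
    unfolding lattice_at_infinity_def
    by (rule eventually_filtercomapI) (rule eventually_ge_at_top)
  have le: "u x \<le> v x"
    if u: "is_solution V f u" "((\<lambda>x. u x / Z \<alpha> x) \<longlongrightarrow> 0) lattice_at_infinity"
      and v: "is_solution V f v" "((\<lambda>x. v x / Z \<alpha> x) \<longlongrightarrow> 0) lattice_at_infinity"
    for u v x
  proof -
    have "u x - v x \<le> 0"
    proof (rule nonpos_if_negligible[where w = "\<lambda>x. u x - v x", OF V_pos _ \<phi>(2) \<phi>(1)])
      fix y
      have "laplacian u y - V y * u y = laplacian v y - V y * v y"
        using u(1) v(1) by (simp add: is_solution_def)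
      thus "V y * (u y - v y) \<le> laplacian (\<lambda>x. u x - v x) y"
        by (simp add: laplacian_diff right_diff_distrib)
    next
      fix \<epsilon> :: real assume \<epsilon>: "\<epsilon> > 0"
      have "((\<lambda>x. u x / Z \<alpha> x - v x / Z \<alpha> x) \<longlongrightarrow> 0 - 0) lattice_at_infinity"
        by (intro tendsto_diff u v)
      hence "\<forall>\<^sub>F x in lattice_at_infinity. \<bar>u x / Z \<alpha> x - v x / Z \<alpha> x\<bar> < \<epsilon>"
        using \<epsilon> by (auto dest: tendstoD simp: dist_real_def)
      thus "\<forall>\<^sub>F x in lattice_at_infinity. u x - v x \<le> \<epsilon> * \<phi> x"
        using far
      proof eventually_elim
        case (elim y)
        have "Z \<alpha> y \<noteq> 0" using elim(2) by (auto simp: Z_def)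
        hence "\<bar>u y - v y\<bar> \<le> \<epsilon> * \<bar>Z \<alpha> y\<bar>"
          using elim(1) by (simp add: diff_divide_distrib[symmetric] abs_divide divide_less_eq)
        also have "\<dots> \<le> \<epsilon> * \<phi> y"
          using Z_le[of y] elim(2) \<epsilon> by (intro mult_left_mono) auto
        finally show ?case by linarith
      qed
    qed
    thus ?thesis by simp
  qed
  show ?thesis
    unfolding Uniq_def by (auto intro!: ext antisym le)
qed

end
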